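(* Consider the $N$-player difference game NZDG and the cost function $J$ of the optimal control problem OCP described in the context. Assume that the cost functions $\{P_k,\ k\in\mathcal K\}$ of OCP satisfy, for every $i\in\mathcal N$, $$\frac{\partial P_k}{\partial u_k^i}=\frac{\partial gu_k^i}{\partial u_k^i},\qquad \frac{\partial P_k}{\partial v_k^i}=\frac{\partial gv_k^i}{\partial v_k^i},\qquad \frac{\partial P_k}{\partial x_k}=\frac{\partial g_k^i}{\partial x_k},\qquad k\in\mathcal K\setminus\{K\},$$ $$\frac{\partial P_K}{\partial x_K}=\frac{\partial g_K^i}{\partial x_K},\qquad \frac{\partial P_K}{\partial v_K^i}=\frac{\partial g_K^i}{\partial v_K^i}$$ (identically in all arguments). Then for each player $i\in\mathcal N$, $$J(x_0,(\tilde u^i,\tilde u^{-i}),(\tilde v^i,\tilde v^{-i}))-J(x_0,(\tilde w^i,\tilde u^{-i}),(\tilde z^i,\tilde v^{-i}))=J^i(x_0,(\tilde u^i,\tilde u^{-i}),(\tilde v^i,\tilde v^{-i}))-J^i(x_0,(\tilde w^i,\tilde u^{-i}),(\tilde z^i,\tilde v^{-i}))$$ for all $\tilde u^i=\{u_k^i\in U_k^i,\ k\in\mathcal K\setminus\{K\}\}$, $\tilde w^i=\{w_k^i\in U_k^i,\ k\in\mathcal K\setminus\{K\}\}$, $\tilde v^i=\{v_k^i\in V_k^i,\ k\in\mathcal K\}$, $\tilde z^i=\{z_k^i\in V_k^i,\ k\in\mathcal K\}$ (and all strategies $\tilde u^{-i},\tilde v^{-i}$ of the other players).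
   Context: Players $\mathcal N=\{1,\dots,N\}$, time periods $\mathcal K=\{0,1,\dots,K\}$. At time $k$ player $i$ chooses $u_k^i\in U_k^i\subset\mathbb R^{m_i}$ (for $k\in\mathcal K\setminus\{K\}$) and $v_k^i\in V_k^i\subset\mathbb R^{s_i}$ (for $k\in\mathcal K$). Put $m=\sum_i m_i$, $s=\sum_i s_i$, $\mathbf u_k=(u_k^1,\dots,u_k^N)\in\mathbb R^m$, $\mathbf v_k=(v_k^1,\dots,v_k^N)\in\mathbb R^s$. The state $x_k\in\mathbb R^n$ evolves by $x_{k+1}=f_k(x_k,\mathbf u_k)$, $k\in\mathcal K\setminus\{K\}$, with $x_0$ given. A strategy of player $i$ is a pair $\tilde u^i=\{u_k^i\}_{k\in\mathcal K\setminus\{K\}}$, $\tilde v^i=\{v_k^i\}_{k\in\mathcal K}$; $-i$ denotes the players other than $i$, and $\tilde{\mathbf u}=(\tilde u^i,\tilde u^{-i})$, $\tilde{\mathbf v}=(\tilde v^i,\tilde v^{-i})$. Game NZDG: player $i$'s cost is $$J^i(x_0,\tilde{\mathbf u},\tilde{\mathbf v})=g_K^i(x_K,\mathbf v_K)+\sum_{k=0}^{K-1}g_k^i(x_k,\mathbf u_k,\mathbf v_k),$$ evaluated along the state trajectory generated by $\tilde{\mathbf u}$ from $x_0$. The instantaneous costs are separable: $g_k^i(x_k,\mathbf u_k,\mathbf v_k)=gu_k^i(x_k,\mathbf u_k)+gv_k^i(x_k,\mathbf v_k)$ for $k\in\mathcal K\setminus\{K\}$. All functions $f_k$, $g_k^i$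 are twice continuously differentiable (defined on the whole Euclidean spaces). OCP cost: for twice continuously differentiable $P_k:\mathbb R^n\times\mathbb R^m\times\mathbb R^s\to\mathbb R$ ($k\in\mathcal K\setminus\{K\}$) and $P_K:\mathbb R^n\times\mathbb R^s\to\mathbb R$, $$J(x_0,\tilde{\mathbf u},\tilde{\mathbf v})=P_K(x_K,\mathbf v_K)+\sum_{k=0}^{K-1}P_k(x_k,\mathbf u_k,\mathbf v_k),$$ again evaluated along the state trajectory generated by $\tilde{\mathbf u}$ from $x_0$ (so each of the terms in the claim is evaluated along the trajectory generated by its own control profile). *)

theory Defs
  imports "HOL-Analysis.Analysis"
begin

text \<open>
  The players form a finite type \<open>'p\<close>.  The coordinates of the joint control space
  $\mathbb R^m$, $m = \sum_i m_i$, form a finite type \<open>'m\<close>, and a map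
  \<open>own :: 'm \<Rightarrow> 'p\<close> says which player owns which coordinate, so that
  $m_i$ is the number of coordinates owned by player $i$; the $m_i$ may differ.
  The space $\mathbb R^{m_i}$ is identified with the coordinate subspace
  \<open>player_space own i\<close> of $\mathbb R^m$.  The controls $v$ are treated in the same way.
\<close>

definition player_space :: "('m::finite \<Rightarrow> 'p) \<Rightarrow> 'p \<Rightarrow> (real^'m) set" where
  "player_space own i = {a. \<forall>c. own c \<noteq> i \<longrightarrow> a $ c = 0}"

text \<open>
  The first argument is a strategy profile: \<open>a i k\<close> is the action of player \<open>i\<close> at time \<open>k\<close>.
  The concatenation $(a_k^1,\dots,a_k^N)$ takes each coordinate from the action of its owner.
\<close>

definition joint :: "('m::finite \<Rightarrow> 'p) \<Rightarrow> ('p \<Rightarrow> nat \<Rightarrow> real^'m) \<Rightarrow> nat \<Rightarrow> real^'m" where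
  "joint own a k = (\<chi> c. a (own c) k $ c)"

primrec trajectory ::
  "(nat \<Rightarrow> real^'n \<Rightarrow> real^'m \<Rightarrow> real^'n) \<Rightarrow> real^'n \<Rightarrow> (nat \<Rightarrow> real^'m) \<Rightarrow> nat \<Rightarrow> real^'n"
where
  "trajectory f x0 u 0 = x0"
| "trajectory f x0 u (Suc k) = f k (trajectory f x0 u k) (u k)"

text \<open>
  \<open>L\<close> is the stage cost at the times below the horizon \<open>K\<close> and \<open>LK\<close> the terminal cost.
  This one functional yields both the cost of a player in the game and the cost of
  the optimal control problem.
\<close>

definition total_cost ::
  "nat \<Rightarrow> (nat \<Rightarrow> real^'n \<Rightarrow> real^'m \<Rightarrow> real^'n) \<Rightarrow>
   (nat \<Rightarrow> real^'n \<Rightarrow> real^'m \<Rightarrow> real^'s \<Rightarrow> real) \<Rightarrow> (real^'n \<Rightarrow> real^'s \<Rightarrow> real) \<Rightarrow>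
   real^'n \<Rightarrow> (nat \<Rightarrow> real^'m) \<Rightarrow> (nat \<Rightarrow> real^'s) \<Rightarrow> real"
where
  "total_cost K f L LK x0 u v =
     LK (trajectory f x0 u K) (v K) + (\<Sum>k<K. L k (trajectory f x0 u k) (u k) (v k))"

definition twice_continuously_differentiable ::
  "('a::real_normed_vector \<Rightarrow> 'b::real_normed_vector) \<Rightarrow> bool"
where
  "twice_continuously_differentiable F \<longleftrightarrow>
     (\<exists>(F' :: 'a \<Rightarrow> 'a \<Rightarrow>\<^sub>L 'b) (F'' :: 'a \<Rightarrow> 'a \<Rightarrow>\<^sub>L ('a \<Rightarrow>\<^sub>L 'b)).
        (\<forall>x. (F has_derivative blinfun_apply (F' x)) (at x)) \<and>
        (\<forall>x. (F' has_derivative blinfun_apply (F'' x)) (at x)) \<and>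
        continuous_on UNIV F'')"

definition grad :: "(real^'a \<Rightarrow> real) \<Rightarrow> real^'a \<Rightarrow> real^'a" where
  "grad F y = (\<chi> c. deriv (\<lambda>t. F (y + t *\<^sub>R axis c 1)) 0)"

text \<open>
  The vector of partial derivatives with respect to the coordinates owned by player \<open>i\<close>,
  as an element of \<open>player_space own i\<close>.
\<close>

definition player_grad ::
  "('m::finite \<Rightarrow> 'p) \<Rightarrow> 'p \<Rightarrow> (real^'m \<Rightarrow> real) \<Rightarrow> real^'m \<Rightarrow> real^'m"
where
  "player_grad own i F y = (\<chi> c. if own c = i then grad F y $ c else 0)"

end

theory Submission
  imports Defs
begin

text \<open>
  For fixed $i$ the difference $P_k - g_k^i$ has vanishing partial derivatives with respect to
  $x_k$, $u_k^i$ and $v_k^i$, hence depends only on $u_k^{-i}$ and $v_k^{-i}$ (and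
  $P_K - g_K^i$ only on $v_K^{-i}$).  A unilateral deviation of player $i$ leaves these
  unchanged, so it changes $J$ and $J^i$ by the same amount, although it alters the trajectory.
\<close>

lemma twice_continuously_differentiable_imp_differentiable:
  assumes "twice_continuously_differentiable F"
  shows "F differentiable (at x)"
  using assms unfolding twice_continuously_differentiable_def differentiable_def by blast

text \<open>\<open>grad\<close> is assembled from one-variable derivatives along the axes and by
  itself says nothing about other directions. Given total differentiability, the chain rule along an
  axis line identifies each entry with the derivative's value on that axis vector, and linearity
  then fixes the derivative everywhere.\<close>

lemma has_derivative_grad:
  fixes F :: "real^'a::finite \<Rightarrow> real"
  assumes "F differentiable (at y)"
  shows "(F has_derivative (\<lambda>h. grad F y \<bullet> h)) (at y)"
proof -
  obtain F' where F': "(F has_derivative F') (at y)"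
    using assms unfolding differentiable_def by blast
  have lin: "linear F'"
    using F' has_derivative_linear by blast
  have axis: "grad F y $ c = F' (axis c 1)" for c
  proof -
    have "((\<lambda>t::real. F (y + t *\<^sub>R axis c 1)) has_derivative (\<lambda>t. F' (t *\<^sub>R axis c 1))) (at 0)"
      by (rule has_derivative_compose[where g = F]) (auto intro!: derivative_eq_intros F')
    then have "((\<lambda>t. F (y + t *\<^sub>R axis c 1)) has_real_derivative F' (axis c 1)) (at 0)"
      by (simp add: has_field_derivative_def linear_scale[OF lin] mult_commute_abs)
    then show ?thesis
      by (simp add: grad_def DERIV_imp_deriv)
  qed
  have "F' h = grad F y \<bullet> h" for h
  proof -
    have "F' h = F' (\<Sum>c\<in>UNIV. (h $ c) *\<^sub>R axis c 1)"
      using basis_expansion[of h] by (simp add: scalar_mult_eq_scaleR)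
    also have "\<dots> = (\<Sum>c\<in>UNIV. h $ c * F' (axis c 1))"
      by (simp add: linear_sum[OF lin] linear_scale[OF lin])
    also have "\<dots> = grad F y \<bullet> h"
      by (simp add: inner_vec_def axis mult.commute)
    finally show ?thesis .
  qed
  then have "F' = (\<lambda>h. grad F y \<bullet> h)"
    by blast
  with F' show ?thesis
    by simp
qed

text \<open>The entries that \<open>player_grad\<close> sets to zero are exactly those where
  \<open>h\<close> already vanishes. This lets hypotheses about one player's partial derivatives
  control directional derivatives along that player's deviations.\<close>

lemma inner_player_grad:
  assumes "h \<in> player_space own i"
  shows "grad F y \<bullet> h = player_grad own i F y \<bullet> h"
  using assms unfolding player_space_def player_grad_def inner_vec_def
  by (auto intro!: sum.cong)

text \<open>On the segment from \<open>b\<close> to \<open>a\<close> the direction is constantly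
  \<open>a - b\<close>, so F and G have equal directional derivatives there and their difference is
  constant. The gradients agree on the whole space, so it does not matter whether the segment stays
  inside an action set.\<close>

lemma diff_eq_if_player_grad_eq:
  fixes F G :: "real^'a::finite \<Rightarrow> real"
  assumes F: "\<And>y. F differentiable (at y)" and G: "\<And>y. G differentiable (at y)"
    and eq: "\<And>y. player_grad own i F y = player_grad own i G y"
    and ab: "a - b \<in> player_space own i"
  shows "F a - F b = G a - G b"
proof -
  define D where "D t = F (b + t *\<^sub>R (a - b)) - G (b + t *\<^sub>R (a - b))" for t :: real
  have line: "((\<lambda>t. H (b + t *\<^sub>R (a - b))) has_derivative
      (\<lambda>s. grad H (b + t *\<^sub>R (a - b)) \<bullet> (s *\<^sub>R (a - b)))) (at t)"
    if "\<And>y. H differentiable (at y)" for H :: "real^'a \<Rightarrow> real" and t :: real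
    by (rule has_derivative_compose[where g = H, OF _ has_derivative_grad[OF that]])
       (auto intro!: derivative_eq_intros)
  have "(D has_derivative (\<lambda>s. 0)) (at t)" for t
    using has_derivative_diff[OF line[OF F] line[OF G], of t]
    by (simp add: D_def[abs_def] inner_player_grad[OF ab] eq)
  then have "D 1 = D 0"
    by (intro has_derivative_zero_unique[where s = UNIV]) auto
  then show ?thesis
    by (simp add: D_def)
qed

text \<open>The case of a single fictitious player who owns every coordinate. It serves for the
  state, whose displacement under a deviation can point in any direction.\<close>

lemma diff_eq_if_grad_eq:
  fixes F G :: "real^'a::finite \<Rightarrow> real"
  assumes "\<And>y. F differentiable (at y)" and "\<And>y. G differentiable (at y)"
    and "\<And>y. grad F y = grad G y"
  shows "F a - F b = G a - G b"
  using assms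
  by (intro diff_eq_if_player_grad_eq[where own = "\<lambda>_. ()" and i = "()"])
     (simp_all add: player_grad_def player_space_def)

lemma joint_deviation_in_player_space:
  "joint own a k - joint own (a(i := b)) k \<in> player_space own i"
  by (simp add: player_space_def joint_def)

lemma differentiable_slice:
  assumes "\<And>p. F differentiable (at p)" and "h differentiable (at y)"
  shows "(\<lambda>y. F (h y)) differentiable (at y)"
  using differentiable_chain_at[OF assms(2) assms(1)] by (simp add: o_def)

theorem lemma3p6:
  fixes K :: nat
    and uown :: "'m::finite \<Rightarrow> 'p::finite"
    and vown :: "'s::finite \<Rightarrow> 'p"
    and U :: "'p \<Rightarrow> nat \<Rightarrow> (real^'m) set"
    and V :: "'p \<Rightarrow> nat \<Rightarrow> (real^'s) set"
    and f :: "nat \<Rightarrow> real^'n \<Rightarrow> real^'m \<Rightarrow> real^'n"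
    and g :: "'p \<Rightarrow> nat \<Rightarrow> real^'n \<Rightarrow> real^'m \<Rightarrow> real^'s \<Rightarrow> real"
    and gu :: "'p \<Rightarrow> nat \<Rightarrow> real^'n \<Rightarrow> real^'m \<Rightarrow> real"
    and gv :: "'p \<Rightarrow> nat \<Rightarrow> real^'n \<Rightarrow> real^'s \<Rightarrow> real"
    and gK :: "'p \<Rightarrow> real^'n \<Rightarrow> real^'s \<Rightarrow> real"
    and P :: "nat \<Rightarrow> real^'n \<Rightarrow> real^'m \<Rightarrow> real^'s \<Rightarrow> real"
    and PK :: "real^'n \<Rightarrow> real^'s \<Rightarrow> real"
    and x0 :: "real^'n"
  assumes U_sub: "\<And>i k. k < K \<Longrightarrow> U i k \<subseteq> player_space uown i"
    and V_sub: "\<And>i k. k \<le> K \<Longrightarrow> V i k \<subseteq> player_space vown i"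
    and f_C2: "\<And>k. k < K \<Longrightarrow> twice_continuously_differentiable (\<lambda>(x, u). f k x u)"
    and g_C2: "\<And>i k. k < K \<Longrightarrow> twice_continuously_differentiable (\<lambda>(x, u, v). g i k x u v)"
    and gK_C2: "\<And>i. twice_continuously_differentiable (\<lambda>(x, v). gK i x v)"
    and separable: "\<And>i k x u v. k < K \<Longrightarrow> g i k x u v = gu i k x u + gv i k x v"
    and P_C2: "\<And>k. k < K \<Longrightarrow> twice_continuously_differentiable (\<lambda>(x, u, v). P k x u v)"
    and PK_C2: "twice_continuously_differentiable (\<lambda>(x, v). PK x v)"
    and P_u: "\<And>i k x u v. k < K \<Longrightarrow>
      player_grad uown i (\<lambda>u. P k x u v) u = player_grad uown i (\<lambda>u. gu i k x u) u"
    and P_v: "\<And>i k x u v. k < K \<Longrightarrow>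
      player_grad vown i (\<lambda>v. P k x u v) v = player_grad vown i (\<lambda>v. gv i k x v) v"
    and P_x: "\<And>i k x u v. k < K \<Longrightarrow>
      grad (\<lambda>x. P k x u v) x = grad (\<lambda>x. g i k x u v) x"
    and PK_x: "\<And>i x v. grad (\<lambda>x. PK x v) x = grad (\<lambda>x. gK i x v) x"
    and PK_v: "\<And>i x v.
      player_grad vown i (\<lambda>v. PK x v) v = player_grad vown i (\<lambda>v. gK i x v) v"
  shows "\<forall>i u v w z.
      (\<forall>j. \<forall>k<K. u j k \<in> U j k) \<and> (\<forall>j. \<forall>k\<le>K. v j k \<in> V j k) \<and>
      (\<forall>k<K. w k \<in> U i k) \<and> (\<forall>k\<le>K. z k \<in> V i k) \<longrightarrow>
      total_cost K f P PK x0 (joint uown u) (joint vown v)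
        - total_cost K f P PK x0 (joint uown (u(i := w))) (joint vown (v(i := z)))
      = total_cost K f (g i) (gK i) x0 (joint uown u) (joint vown v)
        - total_cost K f (g i) (gK i) x0 (joint uown (u(i := w))) (joint vown (v(i := z)))"
proof (intro allI impI, elim conjE)
  fix i u v w z
  let ?u = "joint uown u" and ?u' = "joint uown (u(i := w))"
  let ?v = "joint vown v" and ?v' = "joint vown (v(i := z))"
  let ?x = "trajectory f x0 ?u" and ?x' = "trajectory f x0 ?u'"
  \<comment> \<open>Smoothness is given jointly in all arguments, while the difference lemmas vary
    one block with the others frozen; composing with an affine embedding of that block bridges the
    two.\<close>
  have slice3: "(\<lambda>x. H x b c) differentiable (at a)" "(\<lambda>y. H a y c) differentiable (at b)"
    "(\<lambda>y. H a b y) differentiable (at c)"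
    if "twice_continuously_differentiable (\<lambda>(x, u, v). H x u v)"
    for H :: "real^'n \<Rightarrow> real^'m \<Rightarrow> real^'s \<Rightarrow> real" and a b c
  proof -
    note D = differentiable_slice[OF twice_continuously_differentiable_imp_differentiable[OF that]]
    show "(\<lambda>x. H x b c) differentiable (at a)"
      using D[of "\<lambda>x. (x, b, c)"] by (simp add: differentiable_Pair)
    show "(\<lambda>y. H a y c) differentiable (at b)"
      using D[of "\<lambda>y. (a, y, c)"] by (simp add: differentiable_Pair)
    show "(\<lambda>y. H a b y) differentiable (at c)"
      using D[of "\<lambda>y. (a, b, y)"] by (simp add: differentiable_Pair)
  qed
  have slice2: "(\<lambda>x. H x c) differentiable (at a)" "(\<lambda>y. H a y) differentiable (at c)"
    if "twice_continuously_differentiable (\<lambda>(x, v). H x v)"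
    for H :: "real^'n \<Rightarrow> real^'s \<Rightarrow> real" and a c
  proof -
    note D = differentiable_slice[OF twice_continuously_differentiable_imp_differentiable[OF that]]
    show "(\<lambda>x. H x c) differentiable (at a)"
      using D[of "\<lambda>x. (x, c)"] by (simp add: differentiable_Pair)
    show "(\<lambda>y. H a y) differentiable (at c)"
      using D[of "\<lambda>y. (a, y)"] by (simp add: differentiable_Pair)
  qed
  have stage: "P k (?x k) (?u k) (?v k) - P k (?x' k) (?u' k) (?v' k)
      = g i k (?x k) (?u k) (?v k) - g i k (?x' k) (?u' k) (?v' k)" if k: "k < K" for k
  proof -
    note P = slice3[OF P_C2[OF k]] and g = slice3[OF g_C2[OF k, of i]]
    \<comment> \<open>Smoothness is assumed for the sum g only. Freezing the other control at 0, an
      arbitrary choice, expresses each summand through g up to a constant in the varying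
      control.\<close>
    have gu_eq: "gu i k x y = g i k x y 0 - gv i k x 0"
      and gv_eq: "gv i k x t = g i k x 0 t - gu i k x 0" for x y t
      using separable[OF k] by simp_all
    have gu: "(\<lambda>y. gu i k x y) differentiable (at b)" for x b
      unfolding gu_eq by (intro differentiable_diff g differentiable_const)
    have gv: "(\<lambda>y. gv i k x y) differentiable (at b)" for x b
      unfolding gv_eq by (intro differentiable_diff g differentiable_const)
    \<comment> \<open>The deviation is carried out one block at a time: state, then u, then v. Each
      leg uses one family of gradient equations, and the legs telescope. In the two control legs
      separability cancels the summand of g that does not change.\<close>
    have "P k (?x k) (?u k) (?v k) - P k (?x' k) (?u k) (?v k)
        = g i k (?x k) (?u k) (?v k) - g i k (?x' k) (?u k) (?v k)"
      by (rule diff_eq_if_grad_eq[OF P(1) g(1) P_x[OF k]])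
    moreover have "P k (?x' k) (?u k) (?v k) - P k (?x' k) (?u' k) (?v k)
        = gu i k (?x' k) (?u k) - gu i k (?x' k) (?u' k)"
      by (rule diff_eq_if_player_grad_eq[OF P(2) gu P_u[OF k] joint_deviation_in_player_space])
    moreover have "P k (?x' k) (?u' k) (?v k) - P k (?x' k) (?u' k) (?v' k)
        = gv i k (?x' k) (?v k) - gv i k (?x' k) (?v' k)"
      by (rule diff_eq_if_player_grad_eq[OF P(3) gv P_v[OF k] joint_deviation_in_player_space])
    ultimately show ?thesis
      by (simp add: separable[OF k])
  qed
  \<comment> \<open>No u is chosen at the horizon, so two legs suffice: state, then v.\<close>
  have "PK (?x K) (?v K) - PK (?x' K) (?v K) = gK i (?x K) (?v K) - gK i (?x' K) (?v K)"
    by (rule diff_eq_if_grad_eq[OF slice2(1)[OF PK_C2] slice2(1)[OF gK_C2] PK_x])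
  moreover have "PK (?x' K) (?v K) - PK (?x' K) (?v' K)
      = gK i (?x' K) (?v K) - gK i (?x' K) (?v' K)"
    by (rule diff_eq_if_player_grad_eq[OF slice2(2)[OF PK_C2] slice2(2)[OF gK_C2] PK_v
          joint_deviation_in_player_space])
  moreover have "(\<Sum>k<K. P k (?x k) (?u k) (?v k)) - (\<Sum>k<K. P k (?x' k) (?u' k) (?v' k))
      = (\<Sum>k<K. g i k (?x k) (?u k) (?v k)) - (\<Sum>k<K. g i k (?x' k) (?u' k) (?v' k))"
    unfolding sum_subtractf[symmetric] by (intro sum.cong stage) auto
  ultimately show "total_cost K f P PK x0 ?u ?v - total_cost K f P PK x0 ?u' ?v'
      = total_cost K f (g i) (gK i) x0 ?u ?v - total_cost K f (g i) (gK i) x0 ?u' ?v'"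
    by (simp add: total_cost_def)
qed

end
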